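(* Let $a\ge b>0$. The image of the incircle family with parameters $a,b$ under the scaling $(x,y)\mapsto(s\,x,y)$ along the major axis is a confocal family, where $$s=\sqrt{\frac{b^4+2ab^3}{a^4+2ba^3}}.$$
   Context: Incircle family with parameters $a,b$: the set of all (nondegenerate) triangles inscribed in the ellipse $x^2/a^2+y^2/b^2=1$ whose three sides are tangent to the concentric circle of radius $r=ab/(a+b)$ centered at the origin. (By Poncelet's porism, with this value of $r$, every point of the ellipse is a vertex of exactly one such triangle.) Confocal family: for a pair consisting of an ellipse and a confocal ellipse inside it (concentric, axis-aligned, with semi-axes $\alpha,\beta$ and $\alpha_c,\beta_c$ satisfying $\alpha^2-\beta^2=\alpha_c^2-\beta_c^2$) such that triangles inscribed in the outer ellipse and circumscribed about the inner one exist, the set of all such triangles. Two concentric circles are regarded as the degenerate case of a confocal pair. *)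

theory Defs
  imports "HOL-Analysis.Analysis"
begin

type_synonym point = "real \<times> real"

definition ellipse_form :: "real \<Rightarrow> real \<Rightarrow> point \<Rightarrow> real" where
  "ellipse_form p q P = (fst P)\<^sup>2 / p\<^sup>2 + (snd P)\<^sup>2 / q\<^sup>2"

definition ellipse :: "real \<Rightarrow> real \<Rightarrow> point set" where
  "ellipse p q = {P. ellipse_form p q P = 1}"

lemma circle_eq_sphere:
  assumes "r > 0"
  shows "ellipse r r = sphere 0 r"
proof -
  have "P \<in> ellipse r r \<longleftrightarrow> P \<in> sphere 0 r" for P
  proof -
    have "P \<in> ellipse r r \<longleftrightarrow> (norm P)\<^sup>2 = r\<^sup>2"
      using assms
      by (auto simp add: ellipse_def ellipse_form_def norm_prod_def add_divide_distrib[symmetric])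
    then show ?thesis using assms by (simp add: power2_eq_iff_nonneg)
  qed
  then show ?thesis by blast
qed

definition tangent_line :: "real \<Rightarrow> real \<Rightarrow> point \<Rightarrow> point set" where
  "tangent_line p q P = {Q. frechet_derivative (ellipse_form p q) (at P) (Q - P) = 0}"

lemma tangent_line_eq:
  "tangent_line p q P =
     {Q. 2 * fst P / p\<^sup>2 * (fst Q - fst P) + 2 * snd P / q\<^sup>2 * (snd Q - snd P) = 0}"
proof -
  have "(ellipse_form p q has_derivative (\<lambda>h. 2 * fst P / p\<^sup>2 * fst h + 2 * snd P / q\<^sup>2 * snd h)) (at P)"
    unfolding ellipse_form_def[abs_def] divide_inverse
    by (auto intro!: derivative_eq_intros simp: fun_eq_iff algebra_simps)
  from frechet_derivative_at[OF this, symmetric] show ?thesis unfolding tangent_line_def by simp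
qed

text \<open>The point of tangency is required to lie on the side itself, not merely on the
  line carrying it.\<close>

definition side_tangent :: "real \<Rightarrow> real \<Rightarrow> point \<Rightarrow> point \<Rightarrow> bool" where
  "side_tangent p q A B \<longleftrightarrow>
     (\<exists>P \<in> ellipse p q \<inter> closed_segment A B. affine hull {A, B} = tangent_line p q P)"

text \<open>A triangle is represented by its (unordered) set of vertices.\<close>

definition triangle :: "point set \<Rightarrow> bool" where
  "triangle T \<longleftrightarrow> card T = 3 \<and> \<not> collinear T"

definition inscribed_circumscribed :: "real \<Rightarrow> real \<Rightarrow> real \<Rightarrow> real \<Rightarrow> point set set" where
  "inscribed_circumscribed \<alpha> \<beta> p q =
     {T. triangle T \<and> T \<subseteq> ellipse \<alpha> \<beta> \<and> (\<forall>A\<in>T. \<forall>B\<in>T. A \<noteq> B \<longrightarrow> side_tangent p q A B)}"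

definition incircle_family :: "real \<Rightarrow> real \<Rightarrow> point set set" where
  "incircle_family a b = (let r = a * b / (a + b) in inscribed_circumscribed a b r r)"

text \<open>Neither \<open>\<alpha> \<ge> \<beta>\<close> nor \<open>\<alpha> \<noteq> \<beta>\<close> is imposed: the foci may lie on either coordinate axis,
  and two concentric circles count as a degenerate confocal pair.\<close>

definition confocal_pair :: "real \<Rightarrow> real \<Rightarrow> real \<Rightarrow> real \<Rightarrow> bool" where
  "confocal_pair \<alpha> \<beta> \<alpha>\<^sub>c \<beta>\<^sub>c \<longleftrightarrow>
     0 < \<alpha>\<^sub>c \<and> \<alpha>\<^sub>c < \<alpha> \<and> 0 < \<beta>\<^sub>c \<and> \<beta>\<^sub>c < \<beta> \<and> \<alpha>\<^sup>2 - \<beta>\<^sup>2 = \<alpha>\<^sub>c\<^sup>2 - \<beta>\<^sub>c\<^sup>2"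

definition confocal_family :: "point set set \<Rightarrow> bool" where
  "confocal_family F \<longleftrightarrow>
     (\<exists>\<alpha> \<beta> \<alpha>\<^sub>c \<beta>\<^sub>c. confocal_pair \<alpha> \<beta> \<alpha>\<^sub>c \<beta>\<^sub>c \<and>
        inscribed_circumscribed \<alpha> \<beta> \<alpha>\<^sub>c \<beta>\<^sub>c \<noteq> {} \<and>
        F = inscribed_circumscribed \<alpha> \<beta> \<alpha>\<^sub>c \<beta>\<^sub>c)"

definition scale_x :: "real \<Rightarrow> point \<Rightarrow> point" where
  "scale_x s P = (s * fst P, snd P)"

end

theory Submission
  imports Defs
begin

text \<open>
  Tangency, incidence and non-collinearity are preserved by the linear bijection
  \<open>(x, y) \<mapsto> (s x, y)\<close>, so it carries the triangles between the ellipse with semi-axes \<open>a, b\<close> and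
  the circle of radius \<open>r = a b / (a + b)\<close> exactly onto the triangles between the ellipses with
  semi-axes \<open>s a, b\<close> and \<open>s r, r\<close> (lemma \<open>scale_x_image_inscribed_circumscribed\<close>). Since
  \<open>r < a\<close> and \<open>r < b\<close>, for \<open>s > 0\<close> that pair is confocal iff \<open>s\<^sup>2 (a\<^sup>2 - r\<^sup>2) = b\<^sup>2 - r\<^sup>2\<close>. As
  \<open>a\<^sup>2 - r\<^sup>2 = a\<^sup>3 (a + 2 b) / (a + b)\<^sup>2\<close> and, symmetrically,
  \<open>b\<^sup>2 - r\<^sup>2 = b\<^sup>3 (b + 2 a) / (a + b)\<^sup>2\<close>, the given \<open>s\<close> is its
  positive solution.

  The family must also be shown to be nonempty, for which one explicit triangle suffices. The
  isosceles one with apex \<open>(0, b)\<close> and base on the line \<open>y = - r\<close> has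
  simple coordinates (lemma \<open>incircle_family_nonempty\<close>).
\<close>

section \<open>Tangency under scaling\<close>

lemma linear_scale_x: "linear (scale_x s)"
  by (rule linearI) (auto simp: scale_x_def prod_eq_iff algebra_simps)

lemma inj_scale_x: "s \<noteq> 0 \<Longrightarrow> inj (scale_x s)"
  by (auto simp: inj_def scale_x_def prod_eq_iff)

lemma scale_x_inverse:
  assumes "s * t = 1"
  shows "scale_x s (scale_x t P) = P"
  using assms by (simp add: scale_x_def prod_eq_iff flip: mult.assoc)

lemma ellipse_form_scale_x:
  "s \<noteq> 0 \<Longrightarrow> ellipse_form (s * p) q (scale_x s P) = ellipse_form p q P"
  by (simp add: ellipse_form_def scale_x_def power_mult_distrib)

lemma scale_x_in_tangent_line_iff:
  assumes "s \<noteq> 0"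
  shows "scale_x s Q \<in> tangent_line (s * p) q (scale_x s P) \<longleftrightarrow> Q \<in> tangent_line p q P"
proof -
  have "2 * (s * fst P) / (s * p)\<^sup>2 * (s * fst Q - s * fst P) = 2 * fst P / p\<^sup>2 * (fst Q - fst P)"
    using assms by (cases "p = 0") (simp_all add: power2_eq_square field_simps)
  then show ?thesis
    by (simp add: tangent_line_eq scale_x_def)
qed

lemma scale_x_image_tangent_line:
  assumes "s \<noteq> 0"
  shows "scale_x s ` tangent_line p q P = tangent_line (s * p) q (scale_x s P)"
proof (intro equalityI subsetI)
  fix Q assume "Q \<in> tangent_line (s * p) q (scale_x s P)"
  moreover have "Q = scale_x s (scale_x (1 / s) Q)"
    using assms by (simp add: scale_x_inverse)
  ultimately show "Q \<in> scale_x s ` tangent_line p q P"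
    using scale_x_in_tangent_line_iff[OF assms] by (metis imageI)
next
  fix Q assume "Q \<in> scale_x s ` tangent_line p q P"
  then show "Q \<in> tangent_line (s * p) q (scale_x s P)"
    using scale_x_in_tangent_line_iff[OF assms] by blast
qed

lemma side_tangent_scale_x:
  assumes "s \<noteq> 0" "side_tangent p q A B"
  shows "side_tangent (s * p) q (scale_x s A) (scale_x s B)"
proof -
  obtain P where P: "P \<in> ellipse p q" "P \<in> closed_segment A B"
      "affine hull {A, B} = tangent_line p q P"
    using assms by (auto simp: side_tangent_def)
  have "scale_x s P \<in> ellipse (s * p) q"
    using P assms by (simp add: ellipse_def ellipse_form_scale_x)
  moreover have "scale_x s P \<in> closed_segment (scale_x s A) (scale_x s B)"
    using P closed_segment_linear_image[OF linear_scale_x] by blast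
  moreover have "affine hull {scale_x s A, scale_x s B} = scale_x s ` (affine hull {A, B})"
    using affine_hull_linear_image[of "scale_x s" "{A, B}"] linear_scale_x
    by (simp add: linear_conv_bounded_linear)
  ultimately show ?thesis
    using P scale_x_image_tangent_line[OF assms(1)] by (auto simp: side_tangent_def)
qed

lemma collinear_linear_image:
  assumes "linear f" "collinear S"
  shows "collinear (f ` S)"
proof -
  obtain u where "\<And>x y. x \<in> S \<Longrightarrow> y \<in> S \<Longrightarrow> \<exists>c. x - y = c *\<^sub>R u"
    using assms(2) unfolding collinear_def by blast
  then have "\<exists>c. f x - f y = c *\<^sub>R f u" if "x \<in> S" "y \<in> S" for x y
    using that by (metis assms(1) linear_diff linear_cmul)
  then show ?thesis unfolding collinear_def by blast
qed

lemma triangle_scale_x: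
  assumes "s \<noteq> 0" "triangle T"
  shows "triangle (scale_x s ` T)"
proof -
  have "T = scale_x (1 / s) ` scale_x s ` T"
    using assms by (simp add: image_image scale_x_inverse)
  then have "\<not> collinear (scale_x s ` T)"
    using assms(2) collinear_linear_image[OF linear_scale_x] by (metis triangle_def)
  moreover have "card (scale_x s ` T) = card T"
    using inj_scale_x[OF assms(1)] by (simp add: card_image inj_on_subset)
  ultimately show ?thesis using assms(2) by (simp add: triangle_def)
qed

lemma scale_x_in_inscribed_circumscribed:
  assumes "s \<noteq> 0" "T \<in> inscribed_circumscribed \<alpha> \<beta> p q"
  shows "scale_x s ` T \<in> inscribed_circumscribed (s * \<alpha>) \<beta> (s * p) q"
proof -
  have T: "triangle T" "T \<subseteq> ellipse \<alpha> \<beta>" "\<And>A B. A \<in> T \<Longrightarrow> B \<in> T \<Longrightarrow> A \<noteq> B \<Longrightarrow> side_tangent p q A B"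
    using assms by (auto simp: inscribed_circumscribed_def)
  have "scale_x s ` T \<subseteq> ellipse (s * \<alpha>) \<beta>"
    using T(2) assms(1) by (auto simp: ellipse_def ellipse_form_scale_x simp del: split_paired_All)
  moreover have "side_tangent (s * p) q A B"
    if "A \<in> scale_x s ` T" "B \<in> scale_x s ` T" "A \<noteq> B" for A B
    using that T(3) side_tangent_scale_x[OF assms(1)] by blast
  ultimately show ?thesis
    using triangle_scale_x[OF assms(1) T(1)] by (simp add: inscribed_circumscribed_def)
qed

text \<open>Surjectivity comes from applying the previous lemma to the inverse scaling.\<close>

lemma scale_x_image_inscribed_circumscribed:
  assumes "s \<noteq> 0"
  shows "(\<lambda>T. scale_x s ` T) ` inscribed_circumscribed \<alpha> \<beta> p q =
    inscribed_circumscribed (s * \<alpha>) \<beta> (s * p) q"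
proof (intro equalityI subsetI)
  fix T assume "T \<in> inscribed_circumscribed (s * \<alpha>) \<beta> (s * p) q"
  then have "scale_x (1 / s) ` T \<in> inscribed_circumscribed \<alpha> \<beta> p q"
    using scale_x_in_inscribed_circumscribed[of "1 / s" T "s * \<alpha>" \<beta> "s * p" q] assms by simp
  moreover have "T = scale_x s ` scale_x (1 / s) ` T"
    using assms by (simp add: image_image scale_x_inverse)
  ultimately show "T \<in> (\<lambda>T. scale_x s ` T) ` inscribed_circumscribed \<alpha> \<beta> p q"
    by blast
qed (use assms scale_x_in_inscribed_circumscribed in auto)

section \<open>An isosceles triangle in the incircle family\<close>

lemma affine_hull_eq_plane_line:
  fixes A B :: point
  assumes "A \<noteq> B" "(c, d) \<noteq> (0, 0)"
    and A: "c * fst A + d * snd A = e" and B: "c * fst B + d * snd B = e"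
  shows "affine hull {A, B} = {Q. c * fst Q + d * snd Q = e}"
proof (intro equalityI subsetI)
  fix Q assume "Q \<in> affine hull {A, B}"
  then obtain u v where uv: "u + v = 1" "Q = u *\<^sub>R A + v *\<^sub>R B"
    by (auto simp: affine_hull_2)
  have "c * fst Q + d * snd Q = u * (c * fst A + d * snd A) + v * (c * fst B + d * snd B)"
    by (simp add: uv algebra_simps)
  also have "\<dots> = e"
    using uv A B by (simp flip: distrib_right)
  finally show "Q \<in> {Q. c * fst Q + d * snd Q = e}" by simp
next
  fix Q assume "Q \<in> {Q. c * fst Q + d * snd Q = e}"
  then have Q: "c * (fst Q - fst A) + d * (snd Q - snd A) = 0"
    using A by (simp add: algebra_simps)
  have BA: "c * (fst B - fst A) + d * (snd B - snd A) = 0"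
    using A B by (simp add: algebra_simps)
  (* Q - A and B - A are both orthogonal to (c, d), hence parallel. *)
  obtain t where t: "fst Q - fst A = t * (fst B - fst A)" "snd Q - snd A = t * (snd B - snd A)"
  proof (cases "fst B = fst A")
    case True
    then have ne: "snd B \<noteq> snd A" using \<open>A \<noteq> B\<close> by (simp add: prod_eq_iff)
    then have "d = 0" using BA True by simp
    then have "fst Q = fst A" using Q assms(2) by simp
    with ne True show thesis
      by (intro that[of "(snd Q - snd A) / (snd B - snd A)"]) auto
  next
    case False
    then have "d \<noteq> 0" using BA assms(2) by auto
    define t where "t = (fst Q - fst A) / (fst B - fst A)"
    have x: "fst Q - fst A = t * (fst B - fst A)" using False by (simp add: t_def)
    have "d * (snd Q - snd A) = d * (t * (snd B - snd A))"
      using Q BA unfolding x by algebra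
    with \<open>d \<noteq> 0\<close> x show thesis by (intro that[of t]) auto
  qed
  have "Q = (1 - t) *\<^sub>R A + t *\<^sub>R B"
    using t by (simp add: prod_eq_iff algebra_simps)
  then show "Q \<in> affine hull {A, B}"
    unfolding affine_hull_2
    by (intro CollectI exI[of _ "1 - t"] exI[of _ t]) simp
qed

lemma side_tangent_circleI:
  assumes "r > 0" "A \<noteq> B" and P: "P \<in> closed_segment A B" "(fst P)\<^sup>2 + (snd P)\<^sup>2 = r\<^sup>2"
    and A: "fst P * fst A + snd P * snd A = r\<^sup>2" and B: "fst P * fst B + snd P * snd B = r\<^sup>2"
  shows "side_tangent r r A B"
proof -
  have "(fst P, snd P) \<noteq> (0, 0)" using P \<open>r > 0\<close> by auto
  then have "affine hull {A, B} = {Q. fst P * fst Q + snd P * snd Q = r\<^sup>2}"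
    using affine_hull_eq_plane_line assms(2) A B by blast
  also have "\<dots> = tangent_line r r P"
  proof -
    have "2 * fst P / r\<^sup>2 * (fst Q - fst P) + 2 * snd P / r\<^sup>2 * (snd Q - snd P)
        = 2 / r\<^sup>2 * (fst P * fst Q + snd P * snd Q - ((fst P)\<^sup>2 + (snd P)\<^sup>2))" for Q
      by (simp add: diff_divide_distrib add_divide_distrib power2_eq_square algebra_simps)
    then show ?thesis using P \<open>r > 0\<close> by (auto simp: tangent_line_eq)
  qed
  finally show ?thesis
    using P \<open>r > 0\<close>
    by (auto simp: side_tangent_def ellipse_def ellipse_form_def simp flip: add_divide_distrib)
qed

lemma side_tangent_commute: "side_tangent p q A B \<Longrightarrow> side_tangent p q B A"
  by (simp add: side_tangent_def closed_segment_commute insert_commute)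

text \<open>
  The line \<open>y = - r\<close> meets the ellipse where \<open>x = a k / (a + b)\<close> for the two roots \<open>k\<close> of
  \<open>k\<^sup>2 = b (b + 2 a)\<close>. Leaving the sign of \<open>k\<close> open treats both legs at once. The contact point
  divides the leg, counted from the apex, in the ratio \<open>b : a\<close>.
\<close>

lemma isosceles_leg_tangent:
  fixes a b k :: real
  assumes "a > 0" "b > 0" and k: "k\<^sup>2 = b * (b + 2 * a)"
  defines "r \<equiv> a * b / (a + b)"
  shows "side_tangent r r (0, b) (a * k / (a + b), - r)"
proof (rule side_tangent_circleI)
  let ?P = "(r * k / (a + b), r * a / (a + b))"
  have ab: "a + b \<noteq> 0" using assms by simp
  show "r > 0" using assms by (simp add: r_def)
  then show "(0, b) \<noteq> (a * k / (a + b), - r)" using assms(2) by auto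
  have sq: "k\<^sup>2 + a\<^sup>2 = (a + b)\<^sup>2" unfolding k by algebra
  have "(fst ?P)\<^sup>2 + (snd ?P)\<^sup>2 = r\<^sup>2 * (k\<^sup>2 + a\<^sup>2) / (a + b)\<^sup>2"
    by (simp add: power_mult_distrib power_divide add_divide_distrib distrib_left)
  also have "\<dots> = r\<^sup>2" using ab unfolding sq by simp
  finally show "(fst ?P)\<^sup>2 + (snd ?P)\<^sup>2 = r\<^sup>2" .
  show "fst ?P * fst (0::real, b) + snd ?P * snd (0::real, b) = r\<^sup>2"
    by (simp add: r_def power2_eq_square)
  have "fst ?P * fst (a * k / (a + b), - r) + snd ?P * snd (a * k / (a + b), - r)
      = r * a * (k\<^sup>2 / (a + b) - r) / (a + b)"
    by (simp add: power2_eq_square diff_divide_distrib algebra_simps)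
  also have "k\<^sup>2 / (a + b) - r = b"
    proof -
    have "k\<^sup>2 = b * (a + b) + a * b" unfolding k by algebra
    then show ?thesis using ab by (simp add: r_def add_divide_distrib)
  qed
  also have "r * a * b / (a + b) = r\<^sup>2" by (simp add: r_def power2_eq_square)
  finally show "fst ?P * fst (a * k / (a + b), - r) + snd ?P * snd (a * k / (a + b), - r) = r\<^sup>2" .
  have y: "r * a / (a + b) = (1 - b / (a + b)) * b + b / (a + b) * (- r)"
    unfolding r_def using ab by (simp add: divide_simps) algebra
  show "?P \<in> closed_segment (0, b) (a * k / (a + b), - r)"
    unfolding closed_segment_def
    using assms y by (auto intro!: exI[of _ "b / (a + b)"] simp: r_def)
qed

lemma incircle_family_nonempty:
  fixes a b :: real
  assumes "a > 0" "b > 0"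
  shows "incircle_family a b \<noteq> {}"
proof -
  define r k where "r = a * b / (a + b)" and "k = sqrt (b * (b + 2 * a))"
  define w where "w = a * k / (a + b)"
  have ab: "a + b \<noteq> 0" using assms by simp
  have r: "r > 0" using assms by (simp add: r_def)
  have k: "k\<^sup>2 = b * (b + 2 * a)" "k > 0" using assms by (auto simp: k_def)
  have w: "w > 0" using assms k by (simp add: w_def)
  let ?A = "(0, b)" and ?B = "(w, - r)" and ?C = "(- w, - r)"
  have AB: "side_tangent r r ?A ?B"
    using isosceles_leg_tangent[OF assms k(1)] by (simp add: r_def w_def)
  have AC: "side_tangent r r ?A ?C"
    using isosceles_leg_tangent[OF assms, of "- k"] k(1) by (simp add: r_def w_def)
  have BC: "side_tangent r r ?B ?C"
  proof (rule side_tangent_circleI)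
    show "(0, - r) \<in> closed_segment ?B ?C"
      by (auto simp: closed_segment_def intro!: exI[of _ "1 / 2"])
  qed (use r w in \<open>auto simp: power2_eq_square\<close>)
  have "w\<^sup>2 / a\<^sup>2 + r\<^sup>2 / b\<^sup>2 = (k\<^sup>2 + a\<^sup>2) / (a + b)\<^sup>2"
    using assms by (simp add: w_def r_def power_mult_distrib power_divide add_divide_distrib)
  also have "k\<^sup>2 + a\<^sup>2 = (a + b)\<^sup>2" unfolding k by algebra
  finally have wr: "w\<^sup>2 / a\<^sup>2 + r\<^sup>2 / b\<^sup>2 = 1" using ab by simp
  have "?A \<notin> affine hull {?B, ?C}"
    using w r assms affine_hull_eq_plane_line[of ?B ?C 0 1 "- r"] by simp
  then have "\<not> collinear {?A, ?B, ?C}"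
    using w collinear_3_affine_hull[of ?B ?C ?A] by (simp add: insert_commute)
  moreover have "card {?A, ?B, ?C} = 3" using w r assms by simp
  ultimately have "{?A, ?B, ?C} \<in> inscribed_circumscribed a b r r"
    using assms wr AB AC BC AB[THEN side_tangent_commute] AC[THEN side_tangent_commute]
      BC[THEN side_tangent_commute]
    by (auto simp: inscribed_circumscribed_def triangle_def ellipse_def ellipse_form_def)
  then show ?thesis by (auto simp: incircle_family_def r_def Let_def)
qed

section \<open>The confocal image\<close>

lemma diff_squares_inradius:
  fixes a b :: real
  assumes "a > 0" "b > 0"
  shows "a\<^sup>2 - (a * b / (a + b))\<^sup>2 = a ^ 3 * (a + 2 * b) / (a + b)\<^sup>2"
proof -
  have "a + b \<noteq> 0" using assms by simp
  then show ?thesis by (simp add: power_divide divide_simps) algebra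
qed

theorem lemma1:
  fixes a b s :: real
  assumes "a \<ge> b" and "b > 0"
    and "s = sqrt ((b ^ 4 + 2 * a * b ^ 3) / (a ^ 4 + 2 * b * a ^ 3))"
  shows "confocal_family ((\<lambda>T. scale_x s ` T) ` incircle_family a b)"
proof -
  have a: "a > 0" using assms by simp
  define r where "r = a * b / (a + b)"
  have r: "0 < r" "r < a" "r < b"
    using a assms(2) by (auto simp: r_def field_simps)
  have num: "b ^ 4 + 2 * a * b ^ 3 = b ^ 3 * (b + 2 * a)"
    and den: "a ^ 4 + 2 * b * a ^ 3 = a ^ 3 * (a + 2 * b)" by algebra+
  have s2: "s\<^sup>2 = b ^ 3 * (b + 2 * a) / (a ^ 3 * (a + 2 * b))" and s: "s > 0"
    using a assms(2) unfolding assms(3) num den by simp_all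
  have "s\<^sup>2 * (a\<^sup>2 - r\<^sup>2) = b\<^sup>2 - r\<^sup>2"
    using a assms(2) diff_squares_inradius[of a b] diff_squares_inradius[of b a]
    by (simp add: r_def s2 add.commute mult.commute)
  then have "confocal_pair (s * a) b (s * r) r"
    using r s by (simp add: confocal_pair_def power_mult_distrib algebra_simps)
  moreover have "(\<lambda>T. scale_x s ` T) ` incircle_family a b = inscribed_circumscribed (s * a) b (s * r) r"
    using s scale_x_image_inscribed_circumscribed[of s a b r r]
    by (simp add: incircle_family_def r_def Let_def)
  moreover have "(\<lambda>T. scale_x s ` T) ` incircle_family a b \<noteq> {}"
    using incircle_family_nonempty[OF a assms(2)] by simp
  ultimately show ?thesis
    unfolding confocal_family_def by metis
qed

end
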